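(* The following two assertions are equivalent. (A) (Morgan–Scalzo) For every generalized Nash game with finitely many players $i=1,\dots,p$, strategy sets $C_i$, payoff functions $\theta_i$ and constraint correspondences $K_i$: if for each $i$ the set $C_i$ is compact, convex and non-empty, the payoff function $\theta_i$ is pseudo-continuous on $C$ and quasi-concave in $x_i$, and the correspondence $K_i$ is lower and upper hemicontinuous with convex, closed and non-empty values, then there exists at least one generalized Nash equilibrium. (B) (Arrow–Debreu) For every generalized Nash game with finitely many players $i=1,\dots,p$, strategy sets $C_i$, payoff functions $\theta_i$ and constraint correspondences $K_i$: if for each $i$ the set $C_i$ is compact, convex and non-empty, the payoff function $\theta_i$ is continuous on $C$ and quasi-concave in $x_i$, and the correspondence $K_i$ is lower and upper hemicontinuous with convex, closed and non-empty values, then there exists at least one generalized Nash equilibrium.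
   Context: A generalized Nash game consists of $p$ players; player $i$ has a strategy set $C_i$, a subset of a (real) Hausdorff locally convex topological vector space $E_i$. Put $C=\prod_{i=1}^p C_i$ and $C^{-i}=\prod_{j\neq i}C_j$; for $x\in C$ write $x=(x_i,x_{-i})$ with $x_i\in C_i$, $x_{-i}\in C^{-i}$. Player $i$ has a payoff function $\theta_i:C\to\mathbb{R}$ and a constraint correspondence $K_i:C^{-i}\rightrightarrows C_i$ (each $x_{-i}$ is sent to a subset $K_i(x_{-i})\subset C_i$). A generalized Nash equilibrium is a vector $\hat x\in C$ such that for every $i$, $\hat x_i\in K_i(\hat x_{-i})$ and $\theta_i(\hat x_i,\hat x_{-i})\geq\theta_i(x_i,\hat x_{-i})$ for all $x_i\in K_i(\hat x_{-i})$. "$\theta_i$ is quasi-concave in $x_i$" means that for each $x_{-i}\in C^{-i}$ and $\lambda\in\mathbb{R}$ the set $\{x_i\in C_i:\theta_i(x_i,x_{-i})\geq\lambda\}$ is convex. A function $f:Z\to\mathbb{R}$ on a topological space $Z$ is upper pseudo-continuous if for all $x,y\in Z$ with $f(x)<f(y)$ there is a neighbourhood $V$ of $x$ with $f(x')<f(y)$ for all $x'\in V$; lower pseudo-continuous if $-f$ is upper pseudo-continuous; pseudo-continuous if both. A correspondence $T:A\rightrightarrows B$ between topological spaces is lower hemicontinuous if for all $a\in A$ and open $V\subset B$ with $T(a)\cap V\neq\emptyset$ there is a neighbourhood $W$ of $a$ with $T(a')\cap V\neq\emptyset$ for all $a'\in W$; upper hemicontinuous if for all $a\in A$ and open $V\subset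 B$ with $T(a)\subset V$ there is a neighbourhood $W$ of $a$ with $T(a')\subset V$ for all $a'\in W$. *)

theory Defs
  imports "HOL-Analysis.Analysis"
begin

text \<open>
  The spaces of the players may all be different. Real vector spaces
  \<open>E 1, \<dots>, E p\<close> are represented as linear subspaces of one ambient vector space \<open>'a\<close> (every
  family of vector spaces embeds in its direct sum), each with a topology of its own, whose
  \<^const>\<open>topspace\<close> is the space; the ambient \<open>'a\<close> has no topology, and the topologies of
  different players are unrelated.
\<close>

definition hausdorff_lctvs :: "'a::real_vector topology \<Rightarrow> bool" where
  "hausdorff_lctvs E \<longleftrightarrow>
     subspace (topspace E) \<and>
     continuous_map (prod_topology E E) E (\<lambda>(x, y). x + y) \<and>
     continuous_map (prod_topology euclideanreal E) E (\<lambda>(c, x). c *\<^sub>R x) \<and>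
     Hausdorff_space E \<and>
     neighbourhood_base_at 0 convex E"

definition upper_pseudo_continuous :: "'b topology \<Rightarrow> ('b \<Rightarrow> real) \<Rightarrow> bool" where
  "upper_pseudo_continuous Z f \<longleftrightarrow>
     (\<forall>x\<in>topspace Z. \<forall>y\<in>topspace Z. f x < f y \<longrightarrow>
        (\<exists>V. openin Z V \<and> x \<in> V \<and> (\<forall>x'\<in>V. f x' < f y)))"

definition lower_pseudo_continuous :: "'b topology \<Rightarrow> ('b \<Rightarrow> real) \<Rightarrow> bool" where
  "lower_pseudo_continuous Z f \<longleftrightarrow> upper_pseudo_continuous Z (\<lambda>x. - f x)"

definition pseudo_continuous :: "'b topology \<Rightarrow> ('b \<Rightarrow> real) \<Rightarrow> bool" where
  "pseudo_continuous Z f \<longleftrightarrow> upper_pseudo_continuous Z f \<and> lower_pseudo_continuous Z f"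

definition lower_hemicontinuous :: "'b topology \<Rightarrow> 'c topology \<Rightarrow> ('b \<Rightarrow> 'c set) \<Rightarrow> bool" where
  "lower_hemicontinuous A B T \<longleftrightarrow>
     (\<forall>a\<in>topspace A. \<forall>V. openin B V \<and> T a \<inter> V \<noteq> {} \<longrightarrow>
        (\<exists>W. openin A W \<and> a \<in> W \<and> (\<forall>a'\<in>W. T a' \<inter> V \<noteq> {})))"

definition upper_hemicontinuous :: "'b topology \<Rightarrow> 'c topology \<Rightarrow> ('b \<Rightarrow> 'c set) \<Rightarrow> bool" where
  "upper_hemicontinuous A B T \<longleftrightarrow>
     (\<forall>a\<in>topspace A. \<forall>V. openin B V \<and> T a \<subseteq> V \<longrightarrow>
        (\<exists>W. openin A W \<and> a \<in> W \<and> (\<forall>a'\<in>W. T a' \<subseteq> V)))"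

text \<open>
  A partial profile for a set \<open>J\<close> of players is an extensional function on \<open>J\<close>. For
  \<open>i \<in> {1..p}\<close> and \<open>x \<in> profiles C {1..p}\<close>, the profile \<open>x\<^sub>-\<^sub>i\<close> of the rivals is
  \<open>restrict x (rivals p i)\<close>; for \<open>y \<in> profiles C (rivals p i)\<close> and \<open>z \<in> C i\<close>, the
  profile \<open>(z, y)\<close> is \<open>y(i := z)\<close>.
\<close>

abbreviation rivals :: "nat \<Rightarrow> nat \<Rightarrow> nat set" where
  "rivals p i \<equiv> {1..p} - {i}"

abbreviation profiles :: "(nat \<Rightarrow> 'a set) \<Rightarrow> nat set \<Rightarrow> (nat \<Rightarrow> 'a) set" where
  "profiles C J \<equiv> PiE J C"

abbreviation strategy_topology ::
  "(nat \<Rightarrow> 'a topology) \<Rightarrow> (nat \<Rightarrow> 'a set) \<Rightarrow> nat \<Rightarrow> 'a topology" where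
  "strategy_topology E C i \<equiv> subtopology (E i) (C i)"

abbreviation profile_topology ::
  "(nat \<Rightarrow> 'a topology) \<Rightarrow> (nat \<Rightarrow> 'a set) \<Rightarrow> nat set \<Rightarrow> (nat \<Rightarrow> 'a) topology" where
  "profile_topology E C J \<equiv> product_topology (strategy_topology E C) J"

text \<open>
  Only the values of \<open>K i\<close> on \<open>profiles C (rivals p i)\<close>, and of the payoff functions
  \<open>\<theta> i\<close> on \<open>profiles C {1..p}\<close>, are ever constrained or used.
\<close>

definition generalized_nash_game ::
  "nat \<Rightarrow> (nat \<Rightarrow> 'a::real_vector topology) \<Rightarrow> (nat \<Rightarrow> 'a set) \<Rightarrow>
   (nat \<Rightarrow> (nat \<Rightarrow> 'a) \<Rightarrow> real) \<Rightarrow> (nat \<Rightarrow> (nat \<Rightarrow> 'a) \<Rightarrow> 'a set) \<Rightarrow> bool" where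
  "generalized_nash_game p E C \<theta> K \<longleftrightarrow>
     (\<forall>i\<in>{1..p}. hausdorff_lctvs (E i) \<and> C i \<subseteq> topspace (E i) \<and>
        (\<forall>y\<in>profiles C (rivals p i). K i y \<subseteq> C i))"

definition generalized_nash_equilibrium ::
  "nat \<Rightarrow> (nat \<Rightarrow> 'a set) \<Rightarrow> (nat \<Rightarrow> (nat \<Rightarrow> 'a) \<Rightarrow> real) \<Rightarrow>
   (nat \<Rightarrow> (nat \<Rightarrow> 'a) \<Rightarrow> 'a set) \<Rightarrow> (nat \<Rightarrow> 'a) \<Rightarrow> bool" where
  "generalized_nash_equilibrium p C \<theta> K x \<longleftrightarrow>
     x \<in> profiles C {1..p} \<and>
     (\<forall>i\<in>{1..p}. x i \<in> K i (restrict x (rivals p i)) \<and>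
        (\<forall>z\<in>K i (restrict x (rivals p i)).
           \<theta> i ((restrict x (rivals p i))(i := z)) \<le> \<theta> i x))"

definition quasi_concave_in_own_strategy ::
  "nat \<Rightarrow> (nat \<Rightarrow> 'a::real_vector set) \<Rightarrow> nat \<Rightarrow> ((nat \<Rightarrow> 'a) \<Rightarrow> real) \<Rightarrow> bool" where
  "quasi_concave_in_own_strategy p C i f \<longleftrightarrow>
     (\<forall>y\<in>profiles C (rivals p i). \<forall>c. convex {z \<in> C i. f (y(i := z)) \<ge> c})"

definition admissible_constraint ::
  "nat \<Rightarrow> (nat \<Rightarrow> 'a::real_vector topology) \<Rightarrow> (nat \<Rightarrow> 'a set) \<Rightarrow> nat \<Rightarrow>
   ((nat \<Rightarrow> 'a) \<Rightarrow> 'a set) \<Rightarrow> bool" where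
  "admissible_constraint p E C i T \<longleftrightarrow>
     lower_hemicontinuous (profile_topology E C (rivals p i)) (strategy_topology E C i) T \<and>
     upper_hemicontinuous (profile_topology E C (rivals p i)) (strategy_topology E C i) T \<and>
     (\<forall>y\<in>profiles C (rivals p i).
        convex (T y) \<and> closedin (strategy_topology E C i) (T y) \<and> T y \<noteq> {})"

end

theory Submission
  imports Defs
begin

text \<open>
  Continuity implies pseudo-continuity, so the first assertion contains the second. For the
  converse, the point is that a generalized Nash equilibrium, and quasi-concavity, depend on each
  payoff only through the order that it induces on profiles. A product of convex strategy sets is
  connected, and on a connected space a pseudo-continuous function \<open>f\<close> always has a continuous
  companion \<open>g\<close> inducing the same order (\<open>pseudo_continuous_imp_continuous_representation\<close>); so
  every payoff may be replaced by a continuous one.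

  The companion is built as follows. Pseudo-continuity makes the sections
  \<open>{x. f x < f y}\<close> and \<open>{x. f y < f x}\<close> open. If \<open>f a < f b\<close>, the two open sets
  \<open>{x. f x < f b}\<close> and \<open>{x. f a < f x}\<close> cannot partition a connected space, so some value of
  \<open>f\<close> lies strictly between: the values of \<open>f\<close> are densely ordered, although they may leave gaps
  as subsets of the real line. Density gives a strictly increasing chain of values indexed by the
  dyadic rationals of the unit interval, and from it, as in the proof of Urysohn's lemma, a
  continuous function that is nondecreasing along \<open>f\<close> and separates \<open>a\<close> from \<open>b\<close>
  (\<open>pseudo_continuous_separation\<close>). Countably many such functions, one for each pair of rational
  levels, separate all pairs of values, and a convergent weighted sum of them is \<open>g\<close>.
\<close>

section \<open>Pseudo-continuous functions on connected spaces\<close>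

lemma continuous_map_imp_pseudo_continuous:
  assumes "continuous_map Z euclideanreal f"
  shows "pseudo_continuous Z f"
proof -
  have "upper_pseudo_continuous Z g" if "continuous_map Z euclideanreal g" for g
    unfolding upper_pseudo_continuous_def
  proof (intro ballI impI)
    fix x y assume "x \<in> topspace Z" "y \<in> topspace Z" "g x < g y"
    moreover have "openin Z {z \<in> topspace Z. g z < g y}"
      using that by (simp add: continuous_map_upper_lower_semicontinuous_lt)
    ultimately show "\<exists>V. openin Z V \<and> x \<in> V \<and> (\<forall>x'\<in>V. g x' < g y)"
      by blast
  qed
  then show ?thesis
    using assms continuous_map_minus[of Z f]
    by (simp add: pseudo_continuous_def lower_pseudo_continuous_def)
qed

lemma pseudo_continuous_openin_sections:
  assumes f: "pseudo_continuous Z f" and y: "y \<in> topspace Z"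
  shows "openin Z {x \<in> topspace Z. f x < f y}" "openin Z {x \<in> topspace Z. f y < f x}"
proof -
  have *: "openin Z {x \<in> topspace Z. g x < g y}" if g: "upper_pseudo_continuous Z g" for g
  proof (subst openin_subopen, intro ballI)
    fix x assume "x \<in> {x \<in> topspace Z. g x < g y}"
    then obtain V where V: "openin Z V" "x \<in> V" "\<forall>x'\<in>V. g x' < g y"
      using g y unfolding upper_pseudo_continuous_def by blast
    with openin_subset[OF V(1)]
    show "\<exists>V. openin Z V \<and> x \<in> V \<and> V \<subseteq> {x \<in> topspace Z. g x < g y}"
      by (intro exI[of _ V]) auto
  qed
  show "openin Z {x \<in> topspace Z. f x < f y}" "openin Z {x \<in> topspace Z. f y < f x}"
    using *[of f] *[of "\<lambda>x. - f x"] f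
    by (simp_all add: pseudo_continuous_def lower_pseudo_continuous_def)
qed

lemma pseudo_continuous_values_dense:
  assumes Z: "connected_space Z" and f: "pseudo_continuous Z f"
    and a: "a \<in> topspace Z" and b: "b \<in> topspace Z" and ab: "f a < f b"
  shows "\<exists>c\<in>topspace Z. f a < f c \<and> f c < f b"
proof (rule ccontr)
  assume "\<not> ?thesis"
  then have no: "f c \<le> f a \<or> f b \<le> f c" if "c \<in> topspace Z" for c
    using that by force
  let ?L = "{x \<in> topspace Z. f x < f b}" and ?U = "{x \<in> topspace Z. f a < f x}"
  have "topspace Z \<subseteq> ?L \<union> ?U"
    using no ab by force
  moreover have "?L \<inter> ?U = {}"
    using no by force
  moreover have "?L \<noteq> {}" "?U \<noteq> {}"
    using a b ab by auto
  moreover have "openin Z ?L" "openin Z ?U"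
    using pseudo_continuous_openin_sections[OF f] a b by simp_all
  ultimately show False
    using Z unfolding connected_space_def by meson
qed

lemma dyadics_dense_unit_interval:
  fixes s t :: real
  assumes "0 \<le> s" "s < t" "t \<le> 1"
  obtains r where "r \<in> dyadics \<inter> {0..1}" "s < r" "r < t"
proof -
  have "closure ({s<..<t} \<inter> (\<Union>k m. {of_nat m / 2 ^ k})) = closure {s<..<t}"
    using assms by (intro closure_dyadic_rationals_in_convex_set_pos_1) auto
  then have "{s<..<t} \<inter> (dyadics :: real set) \<noteq> {}"
    using assms by (auto simp: dyadics_def)
  then show thesis
    using assms that by force
qed

text \<open>
  The strict inequality in the definition of the level set \<open>A x\<close> makes \<open>g\<close> lower semicontinuous
  at once: exceeding a level is witnessed by a single member of the chain. For upper
  semicontinuity, one dyadic number strictly between \<open>g x\<close> and the level only gives a weak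
  inequality, and a second one makes it strict.
\<close>

lemma pseudo_continuous_separation:
  fixes f :: "'b \<Rightarrow> real"
  assumes Z: "connected_space Z" and f: "pseudo_continuous Z f"
    and a: "a \<in> topspace Z" and b: "b \<in> topspace Z" and ab: "f a < f b"
  obtains g :: "'b \<Rightarrow> real" where "continuous_map Z euclideanreal g"
    "\<And>x. g x \<in> {0..1}" "\<And>x y. f x \<le> f y \<Longrightarrow> g x \<le> g y"
    "\<And>x. f x \<le> f a \<Longrightarrow> g x = 0" "\<And>x. f b < f x \<Longrightarrow> g x = 1"
proof -
  let ?D = "dyadics \<inter> {0..1::real}"
  let ?R = "\<lambda>x y. x \<in> topspace Z \<and> y \<in> topspace Z \<and> f x < f y"
  have "\<exists>\<phi> :: real \<Rightarrow> 'b. \<phi> 0 = a \<and> \<phi> 1 = b \<and>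
      (\<forall>r\<in>?D. \<forall>s\<in>?D. r < s \<longrightarrow> ?R (\<phi> r) (\<phi> s))"
  proof (rule recursion_on_dyadic_fractions)
    show "\<exists>z. ?R x z \<and> ?R z y" if "?R x y" for x y
      using pseudo_continuous_values_dense[OF Z f] that by metis
  qed (use a b ab in auto)
  then obtain \<phi> :: "real \<Rightarrow> 'b" where \<phi>: "\<phi> 0 = a" "\<phi> 1 = b"
    and \<phi>R: "\<And>r s. r \<in> ?D \<Longrightarrow> s \<in> ?D \<Longrightarrow> r < s \<Longrightarrow> ?R (\<phi> r) (\<phi> s)"
    by blast
  have D: "0 \<in> ?D" "1 \<in> ?D"
    using real_in_dyadics[of 0] real_in_dyadics[of 1] by auto
  have \<phi>Z: "\<phi> r \<in> topspace Z" if "r \<in> ?D" for r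
    using \<phi>R[of r 1] that b \<phi> D by (cases "r = 1") auto
  have \<phi>less: "f (\<phi> r) < f (\<phi> s)" if "r \<in> ?D" "s \<in> ?D" "r < s" for r s
    using \<phi>R that by blast
  have \<phi>mono: "f (\<phi> r) \<le> f (\<phi> s)" if "r \<in> ?D" "s \<in> ?D" "r \<le> s" for r s
    using \<phi>less[of r s] that by (cases "r = s") auto
  define A where "A x = insert 0 {r \<in> ?D. f (\<phi> r) < f x}" for x
  define g where "g x = Sup (A x)" for x
  have A01: "A x \<subseteq> {0..1}" for x
    by (auto simp: A_def)
  have bdd: "bdd_above (A x)" and ne: "A x \<noteq> {}" for x
    using A01 by (auto simp: A_def intro: bdd_above_mono[OF bdd_above_Icc])
  have upper: "r \<le> g x" if "r \<in> A x" for r x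
    unfolding g_def using that bdd by (rule cSup_upper)
  have least: "g x \<le> c" if "\<And>r. r \<in> A x \<Longrightarrow> r \<le> c" for x c
    unfolding g_def using ne that by (rule cSup_least)
  have g0: "0 \<le> g x" for x
    by (rule upper) (simp add: A_def)
  have g1: "g x \<le> 1" for x
    using A01 by (intro least) fastforce
  have mono: "g x \<le> g y" if "f x \<le> f y" for x y
    using that by (intro least upper) (auto simp: A_def)
  have gt_iff: "c < g x \<longleftrightarrow> (\<exists>r\<in>?D. c < r \<and> f (\<phi> r) < f x)" if "0 \<le> c" for c x
    unfolding g_def less_cSup_iff[OF ne bdd] using that by (auto simp: A_def)
  have lt_iff: "g x < c \<longleftrightarrow> (\<exists>r\<in>?D. r < c \<and> f x < f (\<phi> r))" if c: "c \<le> 1" for c x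
  proof
    assume "g x < c"
    then obtain r where r: "r \<in> ?D" "g x < r" "r < c"
      using dyadics_dense_unit_interval[OF g0 _ c] by blast
    then obtain s where s: "s \<in> ?D" "g x < s" "s < r"
      using dyadics_dense_unit_interval[OF g0, of x r] by auto
    have "s \<notin> A x"
      using upper s by fastforce
    then have "f x \<le> f (\<phi> s)"
      using s by (auto simp: A_def)
    also have "\<dots> < f (\<phi> r)"
      using r s by (intro \<phi>less)
    finally show "\<exists>r\<in>?D. r < c \<and> f x < f (\<phi> r)"
      using r by blast
  next
    assume "\<exists>r\<in>?D. r < c \<and> f x < f (\<phi> r)"
    then obtain r where r: "r \<in> ?D" "r < c" "f x < f (\<phi> r)"
      by blast
    have "g x \<le> r"
    proof (rule least)
      fix s assume "s \<in> A x"
      then consider "s = 0" | "s \<in> ?D" "f (\<phi> s) < f x"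
        by (auto simp: A_def)
      then show "s \<le> r"
        using r \<phi>mono[of r s] by cases (simp, argo)
    qed
    with r show "g x < c" by simp
  qed
  have "openin Z {x \<in> topspace Z. c < g x}" for c
  proof (cases "0 \<le> c")
    case True
    have "{x \<in> topspace Z. c < g x} = (\<Union>r\<in>{r\<in>?D. c < r}. {x \<in> topspace Z. f (\<phi> r) < f x})"
      using gt_iff[OF True] by auto
    then show ?thesis
      using pseudo_continuous_openin_sections(2)[OF f \<phi>Z] by auto
  next
    case False
    then have "{x \<in> topspace Z. c < g x} = topspace Z"
      using less_le_trans[OF _ g0] by force
    then show ?thesis by simp
  qed
  moreover have "openin Z {x \<in> topspace Z. g x < c}" for c
  proof (cases "c \<le> 1")
    case True
    have "{x \<in> topspace Z. g x < c} = (\<Union>r\<in>{r\<in>?D. r < c}. {x \<in> topspace Z. f x < f (\<phi> r)})"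
      using lt_iff[OF True] by auto
    then show ?thesis
      using pseudo_continuous_openin_sections(1)[OF f \<phi>Z] by auto
  next
    case False
    then have "{x \<in> topspace Z. g x < c} = topspace Z"
      using le_less_trans[OF g1] by force
    then show ?thesis by simp
  qed
  ultimately have "continuous_map Z euclideanreal g"
    by (simp add: continuous_map_upper_lower_semicontinuous_lt)
  moreover have "g x = 0" if "f x \<le> f a" for x
  proof (rule antisym[OF least g0])
    fix r assume "r \<in> A x"
    then consider "r = 0" | "r \<in> ?D" "f (\<phi> r) < f x"
      by (auto simp: A_def)
    then show "r \<le> 0"
      using that \<phi>mono[of 0 r] D \<phi> by cases auto
  qed
  moreover have "g x = 1" if "f b < f x" for x
    using that D \<phi> by (intro antisym[OF g1 upper]) (auto simp: A_def)
  ultimately show thesis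
    using that g0 g1 mono by auto
qed

lemma continuous_map_weighted_suminf:
  fixes g :: "nat \<Rightarrow> 'b \<Rightarrow> real"
  assumes cont: "\<And>n. continuous_map Z euclideanreal (g n)" and g: "\<And>n x. g n x \<in> {0..1}"
  shows "continuous_map Z euclideanreal (\<lambda>x. \<Sum>n. (1/2)^n * g n x)"
proof -
  have "uniform_limit (topspace Z) (\<lambda>n x. \<Sum>i<n. (1/2)^i * g i x)
      (\<lambda>x. \<Sum>n. (1/2)^n * g n x) sequentially"
  proof (rule Weierstrass_m_test)
    show "norm ((1/2)^n * g n x) \<le> (1/2)^n" for n x
      using g[of n x] by (simp add: abs_mult mult_left_le)
  qed simp
  then have "\<forall>\<^sub>F n in sequentially. \<forall>x\<in>topspace Z.
      dist (\<Sum>i<n. (1/2)^i * g i x) (\<Sum>n. (1/2)^n * g n x) < e" if "0 < e" for e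
    using that by (rule uniform_limitD)
  then have "continuous_map Z (Met_TC.mtopology :: real topology) (\<lambda>x. \<Sum>n. (1/2)^n * g n x)"
    by (intro Met_TC.continuous_map_uniform_limit[where f = "\<lambda>n x. \<Sum>i<n. (1/2)^i * g i x"
          and F = sequentially])
      (auto intro!: always_eventually continuous_map_sum continuous_map_real_mult cont)
  then show ?thesis
    by simp
qed

text \<open>
  Summing countably many separating functions suffices because density of the values puts two
  further values between any two given ones, and rational levels fit into the outer two of the
  three resulting intervals.
\<close>

theorem pseudo_continuous_imp_continuous_representation:
  fixes f :: "'b \<Rightarrow> real"
  assumes Z: "connected_space Z" and f: "pseudo_continuous Z f"
  obtains g where "continuous_map Z euclideanreal g"
    "\<And>x y. x \<in> topspace Z \<Longrightarrow> y \<in> topspace Z \<Longrightarrow> g x \<le> g y \<longleftrightarrow> f x \<le> f y"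
proof -
  define S where "S q g \<longleftrightarrow> continuous_map Z euclideanreal g \<and> (\<forall>x. g x \<in> {0..1}) \<and>
      (\<forall>x y. f x \<le> f y \<longrightarrow> g x \<le> g y) \<and>
      ((\<exists>a\<in>topspace Z. \<exists>b\<in>topspace Z. of_rat (fst q) < f a \<and> f a < f b \<and> f b < of_rat (snd q)) \<longrightarrow>
        (\<forall>x. f x \<le> of_rat (fst q) \<longrightarrow> g x = 0) \<and> (\<forall>x. of_rat (snd q) \<le> f x \<longrightarrow> g x = 1))"
    for q and g :: "'b \<Rightarrow> real"
  have "\<exists>g. S q g" for q
  proof (cases "\<exists>a\<in>topspace Z. \<exists>b\<in>topspace Z.
      of_rat (fst q) < f a \<and> f a < f b \<and> f b < of_rat (snd q)")
    case True
    then obtain a b where ab: "a \<in> topspace Z" "b \<in> topspace Z"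
      "of_rat (fst q) < f a" "f a < f b" "f b < of_rat (snd q)"
      by blast
    obtain g :: "'b \<Rightarrow> real" where "continuous_map Z euclideanreal g"
      "\<And>x. g x \<in> {0..1}" "\<And>x y. f x \<le> f y \<Longrightarrow> g x \<le> g y"
      "\<And>x. f x \<le> f a \<Longrightarrow> g x = 0" "\<And>x. f b < f x \<Longrightarrow> g x = 1"
      using pseudo_continuous_separation[OF Z f ab(1,2,4)] by blast
    moreover have "f x \<le> f a" if "f x \<le> of_rat (fst q)" for x
      using that ab by linarith
    moreover have "f b < f x" if "of_rat (snd q) \<le> f x" for x
      using that ab by linarith
    ultimately have "S q g"
      unfolding S_def by simp
    then show ?thesis by (rule exI[of _ g])
  next
    case False
    then have "S q (\<lambda>x. 0)"
      unfolding S_def by (simp only: simp_thms) auto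
    then show ?thesis by (rule exI[of _ "\<lambda>x. 0"])
  qed
  then have "\<exists>h. \<forall>q. S q (h q)"
    by (intro choice allI)
  then obtain h where h: "\<forall>q. S q (h q)" ..
  define g where "g n = h (from_nat n)" for n
  define G where "G x = (\<Sum>n. (1/2)^n * g n x)" for x
  have g01: "g n x \<in> {0..1}" and cont: "continuous_map Z euclideanreal (g n)"
    and gmono: "f x \<le> f y \<Longrightarrow> g n x \<le> g n y" for n x y
    using h[rule_format, of "from_nat n"] by (simp_all add: S_def g_def)
  have summ: "summable (\<lambda>n. (1/2)^n * g n x)" for x
  proof (rule summable_comparison_test')
    show "summable (\<lambda>n. (1/2)^n :: real)" by simp
    show "norm ((1/2)^n * g n x) \<le> (1/2)^n" if "0 \<le> n" for n
      using g01[of n x] by (simp add: abs_mult mult_left_le)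
  qed
  have Gmono: "G x \<le> G y" if "f x \<le> f y" for x y
    unfolding G_def using gmono[OF that] by (intro suminf_le summ mult_left_mono) auto
  have Gless: "G x < G y" if xy: "x \<in> topspace Z" "y \<in> topspace Z" "f x < f y" for x y
  proof -
    obtain a where a: "a \<in> topspace Z" "f x < f a" "f a < f y"
      using pseudo_continuous_values_dense[OF Z f xy] by blast
    obtain b where b: "b \<in> topspace Z" "f a < f b" "f b < f y"
      using pseudo_continuous_values_dense[OF Z f a(1) xy(2) a(3)] by blast
    obtain q r where q: "f x < of_rat q" "of_rat q < f a" and r: "f b < of_rat r" "of_rat r < f y"
      using of_rat_dense[OF a(2)] of_rat_dense[OF b(3)] by blast
    define n where "n = to_nat (q, r)"
    have "S (q, r) (g n)"
      using h by (simp add: g_def n_def)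
    moreover have "\<exists>a\<in>topspace Z. \<exists>b\<in>topspace Z. of_rat q < f a \<and> f a < f b \<and> f b < of_rat r"
      using a b q r by blast
    ultimately have gn: "g n x = 0" "g n y = 1"
      using q r by (simp_all add: S_def)
    have "0 < (\<Sum>k. (1/2)^k * g k y - (1/2)^k * g k x)"
    proof (rule suminf_pos2[where i = n])
      show "summable (\<lambda>k. (1/2)^k * g k y - (1/2)^k * g k x)"
        by (intro summable_diff summ)
      show "0 \<le> (1/2)^k * g k y - (1/2)^k * g k x" for k
        using gmono[of x y k] xy by (simp add: mult_left_mono)
    qed (simp add: gn)
    also have "\<dots> = G y - G x"
      unfolding G_def by (rule suminf_diff[symmetric, OF summ summ])
    finally show ?thesis by simp
  qed
  have "continuous_map Z euclideanreal G"
    unfolding G_def using cont g01 by (rule continuous_map_weighted_suminf)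
  then show thesis
    using that Gmono Gless by (metis not_le)
qed

section \<open>Strategy spaces and the equivalence\<close>

lemma convex_imp_connectedin_lctvs:
  assumes E: "hausdorff_lctvs E" and CE: "C \<subseteq> topspace E" and C: "convex C"
  shows "connectedin E C"
proof (rule path_connectedin_imp_connectedin, unfold path_connectedin, intro conjI ballI CE)
  fix x y assume xy: "x \<in> C" "y \<in> C"
  have add: "continuous_map (prod_topology E E) E (\<lambda>(x, y). x + y)"
    and scale: "continuous_map (prod_topology euclideanreal E) E (\<lambda>(c, x). c *\<^sub>R x)"
    using E by (auto simp: hausdorff_lctvs_def)
  let ?I = "top_of_set {0..1::real}"
  have scaled: "continuous_map ?I E (\<lambda>t. u t *\<^sub>R z)"
    if "continuous_map ?I euclideanreal u" "z \<in> C" for u z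
  proof -
    have "continuous_map ?I (prod_topology euclideanreal E) (\<lambda>t. (u t, z))"
      using that CE by (auto simp: continuous_map_pairedI)
    from continuous_map_compose[OF this scale] show ?thesis
      by (simp add: o_def)
  qed
  have "continuous_map ?I (prod_topology E E) (\<lambda>t. ((1 - t) *\<^sub>R x, t *\<^sub>R y))"
    using xy by (intro continuous_map_pairedI scaled) (auto intro!: continuous_intros)
  from continuous_map_compose[OF this add] have "pathin E (\<lambda>t. (1 - t) *\<^sub>R x + t *\<^sub>R y)"
    by (simp add: o_def pathin_def)
  moreover have "(\<lambda>t. (1 - t) *\<^sub>R x + t *\<^sub>R y) \<in> {0..1} \<rightarrow> C"
    using C xy by (auto simp: convex_alt)
  ultimately show "\<exists>g. pathin E g \<and> g \<in> {0..1} \<rightarrow> C \<and> g 0 = x \<and> g 1 = y"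
    by (intro exI[of _ "\<lambda>t. (1 - t) *\<^sub>R x + t *\<^sub>R y"]) simp
qed

lemma connected_profile_topology:
  assumes "\<And>i. i \<in> J \<Longrightarrow> hausdorff_lctvs (E i) \<and> C i \<subseteq> topspace (E i) \<and> convex (C i)"
  shows "connected_space (profile_topology E C J)"
  unfolding connected_space_product_topology
  using assms convex_imp_connectedin_lctvs[of "E i" "C i" for i]
  by (metis connectedin_def)

lemma topspace_profile_topology:
  assumes "\<And>i. i \<in> J \<Longrightarrow> C i \<subseteq> topspace (E i)"
  shows "topspace (profile_topology E C J) = profiles C J"
  using assms by (auto simp: topspace_product_topology intro!: PiE_cong)

lemma own_deviation_in_profiles:
  assumes "i \<in> {1..p}" "y \<in> profiles C (rivals p i)" "z \<in> C i"
  shows "y(i := z) \<in> profiles C {1..p}"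
  using assms by (auto simp: PiE_iff extensional_def)

text \<open>
  An upper level set of \<open>g\<close> need not be one of \<open>f\<close>, since \<open>f\<close> may attain no least value
  on it. Convexity is therefore checked one segment at a time: at the level of the lower of the two
  endpoint values, the sets do agree.
\<close>

lemma quasi_concave_in_own_strategy_order_invariant:
  assumes f: "quasi_concave_in_own_strategy p C i f" and i: "i \<in> {1..p}"
    and fg: "\<And>x y. x \<in> profiles C {1..p} \<Longrightarrow> y \<in> profiles C {1..p} \<Longrightarrow> g x \<le> g y \<longleftrightarrow> f x \<le> f y"
  shows "quasi_concave_in_own_strategy p C i g"
  unfolding quasi_concave_in_own_strategy_def
proof (intro ballI allI convexI CollectI)
  fix y :: "nat \<Rightarrow> 'a" and c v w and s t :: real
  assume y: "y \<in> profiles C (rivals p i)"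
    and v: "v \<in> {z \<in> C i. g (y(i := z)) \<ge> c}" and w: "w \<in> {z \<in> C i. g (y(i := z)) \<ge> c}"
    and st: "0 \<le> s" "0 \<le> t" "s + t = 1"
  let ?u = "s *\<^sub>R v + t *\<^sub>R w"
  define m where "m = min (f (y(i := v))) (f (y(i := w)))"
  have "convex {z \<in> C i. f (y(i := z)) \<ge> m}"
    using f y by (simp add: quasi_concave_in_own_strategy_def)
  then have u: "?u \<in> {z \<in> C i. f (y(i := z)) \<ge> m}"
    by (rule convexD) (use v w st in \<open>auto simp: m_def\<close>)
  have in_profiles: "y(i := z) \<in> profiles C {1..p}" if "z \<in> C i" for z
    using own_deviation_in_profiles[OF i y that] .
  from u have "f (y(i := v)) \<le> f (y(i := ?u)) \<or> f (y(i := w)) \<le> f (y(i := ?u))"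
    by (auto simp: m_def)
  then have "g (y(i := v)) \<le> g (y(i := ?u)) \<or> g (y(i := w)) \<le> g (y(i := ?u))"
    using fg in_profiles u v w by simp
  then show "?u \<in> C i \<and> g (y(i := ?u)) \<ge> c"
    using u v w by auto
qed

lemma generalized_nash_equilibrium_order_invariant:
  assumes x: "generalized_nash_equilibrium p C \<eta> K x"
    and K: "\<And>i y. i \<in> {1..p} \<Longrightarrow> y \<in> profiles C (rivals p i) \<Longrightarrow> K i y \<subseteq> C i"
    and order: "\<And>i x y. i \<in> {1..p} \<Longrightarrow> x \<in> profiles C {1..p} \<Longrightarrow> y \<in> profiles C {1..p} \<Longrightarrow>
      \<eta> i x \<le> \<eta> i y \<longleftrightarrow> \<theta> i x \<le> \<theta> i y"
  shows "generalized_nash_equilibrium p C \<theta> K x"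
  unfolding generalized_nash_equilibrium_def
proof (intro conjI ballI)
  show xC: "x \<in> profiles C {1..p}"
    using x by (simp add: generalized_nash_equilibrium_def)
  fix i assume i: "i \<in> {1..p}"
  let ?y = "restrict x (rivals p i)"
  show "x i \<in> K i ?y"
    using x i by (simp add: generalized_nash_equilibrium_def)
  fix z assume z: "z \<in> K i ?y"
  have y: "?y \<in> profiles C (rivals p i)"
    using xC by auto
  then have "?y(i := z) \<in> profiles C {1..p}"
    using K[OF i y] z i by (intro own_deviation_in_profiles) blast+
  moreover have "\<eta> i (?y(i := z)) \<le> \<eta> i x"
    using x i z unfolding generalized_nash_equilibrium_def by blast
  ultimately show "\<theta> i (?y(i := z)) \<le> \<theta> i x"
    using order[OF i] xC by blast
qed

theorem theorem5p5:
  shows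
    "(\<forall>p (E :: nat \<Rightarrow> 'a::real_vector topology) C \<theta> K.
        generalized_nash_game p E C \<theta> K \<and>
        (\<forall>i\<in>{1..p}.
           compactin (E i) (C i) \<and> convex (C i) \<and> C i \<noteq> {} \<and>
           pseudo_continuous (profile_topology E C {1..p}) (\<theta> i) \<and>
           quasi_concave_in_own_strategy p C i (\<theta> i) \<and>
           admissible_constraint p E C i (K i)) \<longrightarrow>
        (\<exists>x. generalized_nash_equilibrium p C \<theta> K x))
     \<longleftrightarrow>
     (\<forall>p (E :: nat \<Rightarrow> 'a::real_vector topology) C \<theta> K.
        generalized_nash_game p E C \<theta> K \<and>
        (\<forall>i\<in>{1..p}.
           compactin (E i) (C i) \<and> convex (C i) \<and> C i \<noteq> {} \<and>
           continuous_map (profile_topology E C {1..p}) euclideanreal (\<theta> i) \<and>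
           quasi_concave_in_own_strategy p C i (\<theta> i) \<and>
           admissible_constraint p E C i (K i)) \<longrightarrow>
        (\<exists>x. generalized_nash_equilibrium p C \<theta> K x))"
  (is "?A \<longleftrightarrow> ?B")
proof
  assume A: ?A
  show ?B
  proof (intro allI impI)
    fix p and E :: "nat \<Rightarrow> 'a topology" and C \<theta> K
    assume "generalized_nash_game p E C \<theta> K \<and>
      (\<forall>i\<in>{1..p}.
         compactin (E i) (C i) \<and> convex (C i) \<and> C i \<noteq> {} \<and>
         continuous_map (profile_topology E C {1..p}) euclideanreal (\<theta> i) \<and>
         quasi_concave_in_own_strategy p C i (\<theta> i) \<and>
         admissible_constraint p E C i (K i))"
    then show "\<exists>x. generalized_nash_equilibrium p C \<theta> K x"
      by (intro A[rule_format, of p E C \<theta> K])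
        (simp add: continuous_map_imp_pseudo_continuous)
  qed
next
  assume B: ?B
  show ?A
  proof (intro allI impI)
    fix p and E :: "nat \<Rightarrow> 'a topology" and C \<theta> K
    let ?Z = "profile_topology E C {1..p}"
    assume asm: "generalized_nash_game p E C \<theta> K \<and>
      (\<forall>i\<in>{1..p}.
         compactin (E i) (C i) \<and> convex (C i) \<and> C i \<noteq> {} \<and>
         pseudo_continuous ?Z (\<theta> i) \<and>
         quasi_concave_in_own_strategy p C i (\<theta> i) \<and>
         admissible_constraint p E C i (K i))"
    then have game: "hausdorff_lctvs (E i)" "C i \<subseteq> topspace (E i)"
        "y \<in> profiles C (rivals p i) \<Longrightarrow> K i y \<subseteq> C i" if "i \<in> {1..p}" for i y
      using that by (auto simp: generalized_nash_game_def)
    have Z: "connected_space ?Z" "topspace ?Z = profiles C {1..p}"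
    proof -
      show "connected_space ?Z"
        using game asm by (intro connected_profile_topology) simp
      show "topspace ?Z = profiles C {1..p}"
        using game by (intro topspace_profile_topology) simp
    qed
    have "\<exists>g. continuous_map ?Z euclideanreal g \<and>
        (\<forall>x\<in>profiles C {1..p}. \<forall>y\<in>profiles C {1..p}. g x \<le> g y \<longleftrightarrow> \<theta> i x \<le> \<theta> i y)"
      if "i \<in> {1..p}" for i
    proof -
      have pc: "pseudo_continuous ?Z (\<theta> i)"
        using asm that by blast
      obtain g where "continuous_map ?Z euclideanreal g"
        "\<And>x y. x \<in> topspace ?Z \<Longrightarrow> y \<in> topspace ?Z \<Longrightarrow> g x \<le> g y \<longleftrightarrow> \<theta> i x \<le> \<theta> i y"
        using pseudo_continuous_imp_continuous_representation[OF Z(1) pc] by blast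
      then show ?thesis
        unfolding Z(2) by (intro exI[of _ g]) simp
    qed
    then have "\<exists>\<eta>. \<forall>i\<in>{1..p}. continuous_map ?Z euclideanreal (\<eta> i) \<and>
        (\<forall>x\<in>profiles C {1..p}. \<forall>y\<in>profiles C {1..p}. \<eta> i x \<le> \<eta> i y \<longleftrightarrow> \<theta> i x \<le> \<theta> i y)"
      by (intro bchoice ballI)
    then obtain \<eta> where \<eta>: "\<And>i. i \<in> {1..p} \<Longrightarrow> continuous_map ?Z euclideanreal (\<eta> i)"
      and order: "\<And>i x y. i \<in> {1..p} \<Longrightarrow> x \<in> profiles C {1..p} \<Longrightarrow> y \<in> profiles C {1..p} \<Longrightarrow>
        \<eta> i x \<le> \<eta> i y \<longleftrightarrow> \<theta> i x \<le> \<theta> i y"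
      by blast
    have "generalized_nash_game p E C \<eta> K"
      using asm by (simp add: generalized_nash_game_def)
    moreover have "quasi_concave_in_own_strategy p C i (\<eta> i)" if "i \<in> {1..p}" for i
      using quasi_concave_in_own_strategy_order_invariant[of p C i "\<theta> i" "\<eta> i"] asm order that
      by blast
    ultimately obtain x where "generalized_nash_equilibrium p C \<eta> K x"
      using B[rule_format, of p E C \<eta> K] \<eta> asm by auto
    then show "\<exists>x. generalized_nash_equilibrium p C \<theta> K x"
      using generalized_nash_equilibrium_order_invariant[of p C \<eta> K x \<theta>] game(3) order by blast
  qed
qed

end
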